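(* Let $a>0$ and $b>0$ with $3a<\min\{1,b\}$. For $n\ge1$ let $t_n=n^{-a}$, $y_n=1+2e^{-4t_n}$, $r_n=y_n\,(n^{-b}-(n+1)^{-b})$, and let $r=\sum_{n\ge1}r_n$. Let $T_{\mathrm i}$ be a discrete random variable with $\mathbb P(T_{\mathrm i}=t_n)=r_n/r$ for every $n\ge1$, and let $T_{\mathrm e}$ be a random variable independent of $T_{\mathrm i}$ with exponential law of parameter $4$, that is, with density $4e^{-4t}$ on $t\ge0$. Then the distribution of $(T_{\mathrm e},T_{\mathrm i})$ is not tame (it does not have a smooth, bounded, everywhere non zero joint density), but it is tempered, with the parameters $$k=3,\quad \alpha=b/a,\quad \varepsilon_1=1,\quad \varepsilon_2=2,\quad\varepsilon_3=3 .$$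
   Context: **Tame.** Every tame prior (in the sense of Steel and Matsen) has a smooth joint probability density on $[0,\infty)^2$ which is bounded and everywhere non zero; "not tame" here means that no such joint density exists. **Tempered.** For $s\in[0,1]$ and $z\in[0,3]$ let $$G(z,s)=\mathbb P\big(e^{-4T_{\mathrm e}}(1-e^{-4T_{\mathrm i}})\le s\,\big|\,e^{-4T_{\mathrm e}}(1+2e^{-4T_{\mathrm i}})=z\big)$$ (a version of the conditional distribution function). For $t>0$ let $4q_0=1+3e^{-4t}$, and for $n\ge1$ let $Q_n(t)=\mathbb P(T_{\mathrm i}\le 1/n,\ t\le T_{\mathrm e}\le t+1/n)$. The law of $(T_{\mathrm e},T_{\mathrm i})$ is tempered if (for a suitable version of $G$): (1) for every $t>0$ there exist $s_0\in(0,1]$, an interval $I_t\subset(0,3)$ which is a neighborhood of $4q_0-1$, an integer $k\ge1$, positive numbers $\alpha,\kappa$, real numbers $0=\varepsilon_0<\varepsilon_1<\dots<\varepsilon_{k-1}\le 2<\varepsilon_k$, and bounded functions $F_0,\dots,F_{k-1}$ on $I_t$, such that for all $s\in[0,s_0]$ and $z\in I_t$, $$\Big|G(z,s)-\sum_{i=0}^{k-1}F_i(z)s^{\alpha+\varepsilon_i}\Big|\le\kappa s^{\alpha+\varepsilon_k};$$ (2) for every $t>0$, $n^{-1}\log Q_n(t)\to0$ as $n\to\infty$. "With the parameters $k,\alpha,\varepsilon_i$" means that condition (1) holds for every $t>0$ with these values of $k,\alpha,\varepsilon_1,\dots,\varepsilon_k$. *)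

theory Defs
  imports "HOL-Probability.Probability"
begin

text \<open>A law of \<open>(T\<^sub>e, T\<^sub>i)\<close> is a Borel probability measure on \<open>real \<times> real\<close>
  giving full mass to the quadrant; the first coordinate is \<open>T\<^sub>e\<close> and the second \<open>T\<^sub>i\<close>.\<close>

definition quadrant :: "(real \<times> real) set" where
  "quadrant = {0..} \<times> {0..}"

text \<open>Smoothness on a subset of the plane, up to the boundary: at a boundary point the
  derivative is taken within the set. On the quadrant the derivative within the set is
  unique, so \<open>g\<close> and \<open>h\<close> below are the two partial derivatives of \<open>f\<close> (one-sided where
  necessary).\<close>

primrec C_times_on :: "nat \<Rightarrow> (real \<times> real) set \<Rightarrow> (real \<times> real \<Rightarrow> real) \<Rightarrow> bool" where
  "C_times_on 0 S f \<longleftrightarrow> continuous_on S f"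
| "C_times_on (Suc m) S f \<longleftrightarrow>
     (\<exists>g h. (\<forall>p\<in>S. (f has_derivative (\<lambda>(u, v). g p * u + h p * v)) (at p within S)) \<and>
            C_times_on m S g \<and> C_times_on m S h)"

definition smooth_on :: "(real \<times> real) set \<Rightarrow> (real \<times> real \<Rightarrow> real) \<Rightarrow> bool" where
  "smooth_on S f \<longleftrightarrow> (\<forall>m. C_times_on m S f)"

definition has_tame_density :: "(real \<times> real) measure \<Rightarrow> bool" where
  "has_tame_density \<mu> \<longleftrightarrow>
     (\<exists>f. smooth_on quadrant f \<and> bounded (f ` quadrant) \<and>
          (\<forall>p\<in>quadrant. 0 \<le> f p \<and> f p \<noteq> 0) \<and>
          \<mu> = density lborel (\<lambda>p. ennreal (f p * indicator quadrant p)))"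

definition X_var :: "real \<times> real \<Rightarrow> real" where
  "X_var = (\<lambda>(te, ti). exp (-4 * te) * (1 - exp (-4 * ti)))"

definition Z_var :: "real \<times> real \<Rightarrow> real" where
  "Z_var = (\<lambda>(te, ti). exp (-4 * te) * (1 + 2 * exp (-4 * ti)))"

text \<open>\<open>G z s\<close> is a version of the conditional distribution function
  \<open>P(X \<le> s | Z = z)\<close>: every \<open>G z\<close> is the restriction to \<open>[0,1]\<close> of the distribution function of
  a probability measure on \<open>[0,1]\<close>, and for every \<open>s\<close> the random variable \<open>G Z s\<close> is a version
  of the conditional expectation of the indicator of \<open>X \<le> s\<close> given the sigma-algebra
  generated by \<open>Z\<close>.\<close>

definition cond_cdf_version :: "(real \<times> real) measure \<Rightarrow> (real \<Rightarrow> real \<Rightarrow> real) \<Rightarrow> bool" where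
  "cond_cdf_version \<mu> G \<longleftrightarrow>
     (\<forall>z\<in>{0..3}. \<exists>\<nu>. real_distribution \<nu> \<and> measure \<nu> {0..1} = 1 \<and>
                      (\<forall>s\<in>{0..1}. G z s = cdf \<nu> s)) \<and>
     (\<forall>s\<in>{0..1}.
        (\<lambda>z. G z s) \<in> borel_measurable (restrict_space borel {0..3}) \<and>
        (AE p in \<mu>.
           real_cond_exp \<mu> (vimage_algebra (space \<mu>) Z_var borel)
             (indicator {p'. X_var p' \<le> s}) p = G (Z_var p) s))"

definition q0 :: "real \<Rightarrow> real" where
  "q0 t = (1 + 3 * exp (-4 * t)) / 4"

definition Q :: "(real \<times> real) measure \<Rightarrow> real \<Rightarrow> nat \<Rightarrow> real" where
  "Q \<mu> t n = measure \<mu> {(te, ti). ti \<le> 1 / real n \<and> t \<le> te \<and> te \<le> t + 1 / real n}"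

text \<open>Since all exponents \<open>\<alpha> + \<epsilon> i\<close> are positive, the convention \<open>0 powr x = 0\<close> is the right
  one at \<open>s = 0\<close>.\<close>

definition tempered_expansion ::
  "(real \<Rightarrow> real \<Rightarrow> real) \<Rightarrow> real \<Rightarrow> nat \<Rightarrow> real \<Rightarrow> (nat \<Rightarrow> real) \<Rightarrow> bool" where
  "tempered_expansion G t k \<alpha> \<epsilon> \<longleftrightarrow>
     1 \<le> k \<and> 0 < \<alpha> \<and>
     \<epsilon> 0 = 0 \<and> (\<forall>i<k. \<epsilon> i < \<epsilon> (Suc i)) \<and> \<epsilon> (k - 1) \<le> 2 \<and> 2 < \<epsilon> k \<and>
     (\<exists>s0 I \<kappa> F.
        0 < s0 \<and> s0 \<le> 1 \<and>
        is_interval I \<and> I \<subseteq> {0<..<3} \<and> 4 * q0 t - 1 \<in> interior I \<and>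
        0 < \<kappa> \<and> (\<forall>i<k. bounded (F i ` I)) \<and>
        (\<forall>s\<in>{0..s0}. \<forall>z\<in>I.
           \<bar>G z s - (\<Sum>i<k. F i z * s powr (\<alpha> + \<epsilon> i))\<bar> \<le> \<kappa> * s powr (\<alpha> + \<epsilon> k)))"

text \<open>Because \<open>ln 0 = 0\<close> here, positivity of \<open>Q \<mu> t n\<close> has to be required explicitly: in the
  source \<open>log 0 = -\<infinity>\<close>.\<close>

definition tempered_log :: "(real \<times> real) measure \<Rightarrow> real \<Rightarrow> bool" where
  "tempered_log \<mu> t \<longleftrightarrow>
     (\<forall>\<^sub>F n in sequentially. 0 < Q \<mu> t n) \<and> (\<lambda>n. ln (Q \<mu> t n) / real n) \<longlonglongrightarrow> 0"

definition tempered :: "(real \<times> real) measure \<Rightarrow> bool" where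
  "tempered \<mu> \<longleftrightarrow>
     (\<exists>G. cond_cdf_version \<mu> G \<and> (\<forall>t>0. \<exists>k \<alpha> \<epsilon>. tempered_expansion G t k \<alpha> \<epsilon>)) \<and>
     (\<forall>t>0. tempered_log \<mu> t)"

definition tempered_with_parameters ::
  "(real \<times> real) measure \<Rightarrow> nat \<Rightarrow> real \<Rightarrow> (nat \<Rightarrow> real) \<Rightarrow> bool" where
  "tempered_with_parameters \<mu> k \<alpha> \<epsilon> \<longleftrightarrow>
     (\<exists>G. cond_cdf_version \<mu> G \<and> (\<forall>t>0. tempered_expansion G t k \<alpha> \<epsilon>)) \<and>
     (\<forall>t>0. tempered_log \<mu> t)"

end

theory Submission
  imports Defs "HOL-Real_Asymp.Real_Asymp"
begin

text \<open>
  The law is not tame because \<open>T\<^sub>i\<close> has atoms: each atom \<open>u\<close> puts positive mass on the line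
  \<open>UNIV \<times> {u}\<close>, which is Lebesgue null, so there is no joint density
  (\<open>atom_imp_not_tame\<close>).

  For temperedness, note that \<open>exp (-4 T\<^sub>e)\<close> is uniform on \<open>[0,1]\<close>. Given \<open>T\<^sub>i = u\<close>, the variable
  \<open>Z\<close> is therefore uniform on \<open>[0, y]\<close> with \<open>y = 1 + 2 exp (-4 u)\<close>, while the quotient \<open>X / Z\<close> is a
  function \<open>h u\<close> of \<open>u\<close> alone. The factor \<open>y\<^sub>n\<close> in the mass \<open>r\<^sub>n / R\<close> of \<open>t\<^sub>n\<close> cancels the density
  \<open>1 / y\<^sub>n\<close> of \<open>Z\<close>. Hence, given \<open>Z = z\<close>, the index \<open>n\<close> has the law with weights
  \<open>w\<^sub>n = n powr -b - (n+1) powr -b\<close>, conditioned on \<open>z \<le> y\<^sub>n\<close>, and \<open>X = z h(t\<^sub>n)\<close>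
  (\<open>nn_integral_law\<close>, \<open>cond_cdf_version_law\<close>).

  The weights \<open>w\<^sub>n\<close> telescope: the mass of the indices that are at least \<open>m\<close> is \<open>m powr -b\<close>. Moreover
  \<open>z h(t\<^sub>n) \<le> s\<close> means \<open>t\<^sub>n \<le> \<phi> (s / z)\<close> where \<open>\<phi> x = ln ((1 + 2 x) / (1 - x)) / 4\<close> inverts \<open>h\<close>, that
  is, \<open>n \<ge> \<phi> (s / z) powr (-1 / a)\<close>. For small \<open>s\<close> this condition already implies \<open>z \<le> y\<^sub>n\<close>. Up to
  the rounding of this threshold to an integer, \<open>G z s\<close> is thus proportional to
  \<open>\<phi> (s / z) powr (b / a)\<close>. Since \<open>\<phi>\<close> is analytic with a simple zero at \<open>0\<close>, this power has an
  expansion with exponents \<open>b / a\<close>, \<open>b / a + 1\<close>, \<open>b / a + 2\<close> and an error of order \<open>b / a + 3\<close>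
  (\<open>time_bound_powr_expansion\<close>). Rounding costs a relative error of order \<open>s powr (1 / a)\<close>, which is
  of order \<open>s\<^sup>3\<close> or smaller because \<open>3 a \<le> 1\<close> (\<open>prob_power_time_le_approx\<close>).

  Finally, \<open>Q n\<close> is a product of an exponential probability of order \<open>1 / n\<close> and the mass of
  the indices beyond \<open>n powr (1 / a)\<close>, so it decays only polynomially (\<open>tempered_log_power\<close>).
\<close>

section \<open>The law of \<open>(T\<^sub>e, T\<^sub>i)\<close> and its coordinates\<close>

abbreviation exp4_law :: "real measure" where
  "exp4_law \<equiv> density lborel (exponential_density 4)"

text \<open>The largest value of \<open>Z\<close> when \<open>T\<^sub>i = u\<close>; it is attained at \<open>T\<^sub>e = 0\<close>.\<close>
definition Z_max :: "real \<Rightarrow> real" where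
  "Z_max u = 1 + 2 * exp (-4 * u)"

text \<open>The value of \<open>X / Z\<close> when \<open>T\<^sub>i = u\<close>, whatever the value of \<open>T\<^sub>e\<close>.\<close>
definition XZ_ratio :: "real \<Rightarrow> real" where
  "XZ_ratio u = (1 - exp (-4 * u)) / Z_max u"

text \<open>The law of \<open>T\<^sub>i\<close>: the index is biased by \<open>Z_max\<close> with respect to \<open>N\<close>, so that
  the law of the index given \<open>Z = z\<close> is \<open>N\<close> conditioned on \<open>z \<le> Z_max (\<tau> i)\<close>. The constant \<open>c\<close> is the
  normalisation; it is the parameter \<open>R\<close> of the theorem.\<close>
definition tilted :: "nat pmf \<Rightarrow> (nat \<Rightarrow> real) \<Rightarrow> real \<Rightarrow> real measure" where
  "tilted N \<tau> c = distr (density (measure_pmf N) (\<lambda>i. ennreal (Z_max (\<tau> i) / c))) borel \<tau>"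

text \<open>The conditional distribution function of \<open>z * XZ_ratio (\<tau> i)\<close> when \<open>i\<close> follows \<open>N\<close> conditioned on
  \<open>z \<le> Z_max (\<tau> i)\<close>. If this event is null (for example \<open>z = 3\<close> when all times are positive),
  the value \<open>1\<close> makes it the distribution function of the point mass at \<open>0\<close>.\<close>
definition cond_cdf :: "nat pmf \<Rightarrow> (nat \<Rightarrow> real) \<Rightarrow> real \<Rightarrow> real \<Rightarrow> real" where
  "cond_cdf N \<tau> z s =
     (if measure_pmf.prob N {i. z \<le> Z_max (\<tau> i)} = 0 then 1
      else measure_pmf.prob N {i. z \<le> Z_max (\<tau> i) \<and> z * XZ_ratio (\<tau> i) \<le> s} /
           measure_pmf.prob N {i. z \<le> Z_max (\<tau> i)})"

lemma Z_max_gt_1: "1 < Z_max u"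
  by (simp add: Z_max_def)

lemma Z_max_pos: "0 < Z_max u"
  using Z_max_gt_1[of u] by linarith

lemma Z_max_le_3: "0 \<le> u \<Longrightarrow> Z_max u \<le> 3"
  by (simp add: Z_max_def)

lemma XZ_ratio_nonneg: "0 \<le> u \<Longrightarrow> 0 \<le> XZ_ratio u"
  using Z_max_pos[of u] by (simp add: XZ_ratio_def)

lemma measurable_Z_max [measurable]: "Z_max \<in> borel_measurable borel"
  unfolding Z_max_def[abs_def] by measurable

lemma measurable_XZ_ratio [measurable]: "XZ_ratio \<in> borel_measurable borel"
  unfolding XZ_ratio_def[abs_def] by measurable

lemma measurable_X_var [measurable]: "X_var \<in> borel_measurable (borel \<Otimes>\<^sub>M borel)"
  unfolding X_var_def by measurable

lemma measurable_Z_var [measurable]: "Z_var \<in> borel_measurable (borel \<Otimes>\<^sub>M borel)"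
  unfolding Z_var_def by measurable

lemma Z_var_eq: "Z_var p = exp (-4 * fst p) * Z_max (snd p)"
  by (simp add: Z_var_def Z_max_def split_beta)

lemma X_var_eq: "X_var p = Z_var p * XZ_ratio (snd p)"
  using Z_max_pos[of "snd p"] by (simp add: X_var_def XZ_ratio_def Z_var_eq split_beta)

lemma prob_space_exp4_law: "prob_space exp4_law"
  by (rule prob_space_exponential_density) simp

lemma sets_tilted [simp, measurable_cong]: "sets (tilted N \<tau> c) = sets borel"
  by (simp add: tilted_def)

section \<open>Disintegration along \<open>Z\<close>\<close>

text \<open>If \<open>x\<close> is exponential with parameter \<open>4\<close>, then \<open>exp (-4 x) y\<close> is uniform on \<open>[0, y]\<close>.\<close>
lemma nn_integral_scaled_exp:
  fixes f :: "real \<Rightarrow> ennreal"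
  assumes "0 < y" and [measurable]: "f \<in> borel_measurable borel"
  shows "(\<integral>\<^sup>+x. f (exp (-4 * x) * y) \<partial>exp4_law) =
    ennreal (1 / y) * (\<integral>\<^sup>+z. indicator {0..y} z * f z \<partial>lborel)"
proof -
  interpret E: prob_space exp4_law by (rule prob_space_exp4_law)
  let ?X = "\<lambda>x. exp (-4 * x) * y"
  have "distributed exp4_law lborel ?X (\<lambda>x. ennreal (indicator {0..y} x / measure lborel {0..y}))"
  proof (rule E.uniform_distrI_borel_atLeastAtMost)
    show "?X \<in> borel_measurable exp4_law" by measurable
    show "0 < y" by fact
    fix t assume t: "0 \<le> t" "t \<le> y"
    show "\<P>(x in exp4_law. ?X x \<le> t) = (t - 0) / (y - 0)"
    proof (cases "t = 0")
      case True
      then have "{x \<in> space exp4_law. ?X x \<le> t} = {}"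
        using \<open>0 < y\<close> by (auto simp: not_le)
      then show ?thesis using True by simp
    next
      case False
      define a where "a = - ln (t / y) / 4"
      have a: "0 \<le> a" using t False \<open>0 < y\<close> by (simp add: a_def)
      have iff: "?X x \<le> t \<longleftrightarrow> a \<le> x" for x
      proof -
        have "?X x \<le> t \<longleftrightarrow> exp (-4 * x) \<le> t / y"
          using \<open>0 < y\<close> by (simp add: field_simps)
        also have "\<dots> \<longleftrightarrow> -4 * x \<le> ln (t / y)"
          using t False \<open>0 < y\<close> by (subst ln_ge_iff) auto
        finally show ?thesis by (auto simp: a_def)
      qed
      have "distributed exp4_law lborel (\<lambda>x. x) (exponential_density 4)"
        by (auto simp: distributed_def distr_id2)
      from E.exponential_distributedD_gt[OF this a]
      have "\<P>(x in exp4_law. a < x) = exp (- a * 4)" by simp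
      moreover have "\<P>(x in exp4_law. ?X x \<le> t) = \<P>(x in exp4_law. a < x)"
      proof (rule E.finite_measure_eq_AE)
        have "AE x in lborel. x \<noteq> a" by (rule AE_lborel_singleton)
        with iff show "AE x in exp4_law. (x \<in> {x \<in> space exp4_law. ?X x \<le> t}) = (x \<in> {x \<in> space exp4_law. a < x})"
          by (subst AE_density) (auto simp: order_less_le simp del: exponential_density_def)
      qed (simp_all only: iff, measurable)
      moreover have "exp (- a * 4) = t / y"
        using t False \<open>0 < y\<close> by (simp add: a_def)
      ultimately show ?thesis by simp
    qed
  qed
  from distributed_nn_integral[OF this, of f]
  have "(\<integral>\<^sup>+x. f (exp (-4 * x) * y) \<partial>exp4_law) =
      (\<integral>\<^sup>+z. ennreal (indicator {0..y} z / y) * f z \<partial>lborel)"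
    using \<open>0 < y\<close> by simp
  also have "\<dots> = (\<integral>\<^sup>+z. ennreal (1 / y) * (indicator {0..y} z * f z) \<partial>lborel)"
    by (intro nn_integral_cong) (auto split: split_indicator)
  also have "\<dots> = ennreal (1 / y) * (\<integral>\<^sup>+z. indicator {0..y} z * f z \<partial>lborel)"
    by (rule nn_integral_cmult) measurable
  finally show ?thesis .
qed

text \<open>Given \<open>T\<^sub>i = \<tau> i\<close>, the density of \<open>Z\<close> is \<open>1 / Z_max (\<tau> i)\<close> on \<open>[0, Z_max (\<tau> i)]\<close>. This cancels the
  bias in \<open>tilted\<close>. After exchanging the order of integration, \<open>z\<close> acts on the weights of the
  index only through the constraint \<open>z \<le> Z_max (\<tau> i)\<close>. This is Bayes' formula for the index
  given \<open>Z\<close>.\<close>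
lemma nn_integral_law:
  fixes g :: "real \<times> real \<Rightarrow> ennreal"
  assumes "0 < c" and prob: "prob_space (tilted N \<tau> c)"
    and [measurable]: "g \<in> borel_measurable (borel \<Otimes>\<^sub>M borel)"
  shows "(\<integral>\<^sup>+p. g (Z_var p, snd p) \<partial>(exp4_law \<Otimes>\<^sub>M tilted N \<tau> c)) =
    ennreal (1 / c) *
      (\<integral>\<^sup>+z. (\<integral>\<^sup>+i. indicator {0..Z_max (\<tau> i)} z * g (z, \<tau> i) \<partial>measure_pmf N) \<partial>lborel)"
proof -
  interpret E: prob_space exp4_law by (rule prob_space_exp4_law)
  interpret T: prob_space "tilted N \<tau> c" by (rule prob)
  interpret ET: pair_sigma_finite exp4_law "tilted N \<tau> c" ..
  interpret NL: pair_sigma_finite lborel "measure_pmf N" ..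
  define J where "J u = (\<integral>\<^sup>+z. indicator {0..Z_max u} z * g (z, u) \<partial>lborel)" for u
  have [measurable]: "(\<lambda>(u, z). indicator {0..Z_max u} z * g (z, u)) \<in> borel_measurable (borel \<Otimes>\<^sub>M lborel)"
    by (simp add: indicator_def)
  have [measurable]: "J \<in> borel_measurable borel"
    unfolding J_def[abs_def] by measurable
  have "(\<integral>\<^sup>+p. g (Z_var p, snd p) \<partial>(exp4_law \<Otimes>\<^sub>M tilted N \<tau> c)) =
      (\<integral>\<^sup>+u. (\<integral>\<^sup>+x. g (exp (-4 * x) * Z_max u, u) \<partial>exp4_law) \<partial>tilted N \<tau> c)"
    by (subst ET.nn_integral_snd[symmetric]) (auto simp: Z_var_eq)
  also have "\<dots> = (\<integral>\<^sup>+u. ennreal (1 / Z_max u) * J u \<partial>tilted N \<tau> c)"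
    unfolding J_def by (intro nn_integral_cong nn_integral_scaled_exp Z_max_pos) measurable
  also have "\<dots> = (\<integral>\<^sup>+i. ennreal (Z_max (\<tau> i) / c) * (ennreal (1 / Z_max (\<tau> i)) * J (\<tau> i)) \<partial>measure_pmf N)"
    unfolding tilted_def by (subst nn_integral_distr, simp_all, subst nn_integral_density) auto
  also have "\<dots> = (\<integral>\<^sup>+i. ennreal (1 / c) * J (\<tau> i) \<partial>measure_pmf N)"
  proof (intro nn_integral_cong)
    fix i
    have "ennreal (Z_max (\<tau> i) / c) * ennreal (1 / Z_max (\<tau> i)) = ennreal (1 / c)"
      using Z_max_pos[of "\<tau> i"] \<open>0 < c\<close> by (subst ennreal_mult'[symmetric]) auto
    then show "ennreal (Z_max (\<tau> i) / c) * (ennreal (1 / Z_max (\<tau> i)) * J (\<tau> i)) = ennreal (1 / c) * J (\<tau> i)"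
      by (simp add: mult.assoc[symmetric])
  qed
  also have "\<dots> = ennreal (1 / c) * (\<integral>\<^sup>+i. J (\<tau> i) \<partial>measure_pmf N)"
    by (rule nn_integral_cmult) simp
  also have "(\<integral>\<^sup>+i. J (\<tau> i) \<partial>measure_pmf N) =
      (\<integral>\<^sup>+z. (\<integral>\<^sup>+i. indicator {0..Z_max (\<tau> i)} z * g (z, \<tau> i) \<partial>measure_pmf N) \<partial>lborel)"
    unfolding J_def
    by (rule NL.Fubini') (simp add: indicator_def)
  finally show ?thesis .
qed

lemma antimono_borel_measurable:
  fixes f :: "real \<Rightarrow> real"
  assumes "antimono f" shows "f \<in> borel_measurable borel"
proof -
  have "mono (\<lambda>x. - f x)" using assms by (auto simp: monotone_def)
  from borel_measurable_mono[OF this] show ?thesis by simp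
qed

text \<open>Numerator and denominator are both nonincreasing in \<open>z\<close>, because \<open>XZ_ratio\<close> is nonnegative.\<close>
lemma cond_cdf_measurable:
  assumes "\<And>i. 0 \<le> \<tau> i"
  shows "(\<lambda>z. cond_cdf N \<tau> z s) \<in> borel_measurable borel"
proof -
  have [measurable]: "(\<lambda>z. measure_pmf.prob N {i. z \<le> Z_max (\<tau> i)}) \<in> borel_measurable borel"
    by (rule antimono_borel_measurable)
       (auto simp: monotone_def intro!: measure_pmf.finite_measure_mono)
  have [measurable]: "(\<lambda>z. measure_pmf.prob N {i. z \<le> Z_max (\<tau> i) \<and> z * XZ_ratio (\<tau> i) \<le> s})
      \<in> borel_measurable borel"
  proof (rule antimono_borel_measurable)
    have "x * XZ_ratio (\<tau> i) \<le> y * XZ_ratio (\<tau> i)" if "x \<le> y" for x y i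
      using that XZ_ratio_nonneg[OF assms] by (rule mult_right_mono)
    then show "antimono (\<lambda>z. measure_pmf.prob N {i. z \<le> Z_max (\<tau> i) \<and> z * XZ_ratio (\<tau> i) \<le> s})"
      by (auto simp: monotone_def intro!: measure_pmf.finite_measure_mono intro: order_trans)
  qed
  show ?thesis unfolding cond_cdf_def by measurable
qed

text \<open>The quotient defining \<open>cond_cdf\<close> can be cleared without excluding the null case: the numerator
  vanishes together with the denominator.\<close>
lemma cond_cdf_times_weight:
  "cond_cdf N \<tau> z s * measure_pmf.prob N {i. z \<le> Z_max (\<tau> i)} =
   measure_pmf.prob N {i. z \<le> Z_max (\<tau> i) \<and> z * XZ_ratio (\<tau> i) \<le> s}"
proof (cases "measure_pmf.prob N {i. z \<le> Z_max (\<tau> i)} = 0")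
  case True
  have "measure_pmf.prob N {i. z \<le> Z_max (\<tau> i) \<and> z * XZ_ratio (\<tau> i) \<le> s}
      \<le> measure_pmf.prob N {i. z \<le> Z_max (\<tau> i)}"
    by (rule measure_pmf.finite_measure_mono) auto
  with True show ?thesis by (simp add: measure_le_0_iff)
qed (simp add: cond_cdf_def)

text \<open>The values lie in \<open>[0,1]\<close> since \<open>z * XZ_ratio u \<le> Z_max u * XZ_ratio u = 1 - exp (-4 u)\<close> on the
  conditioning event.\<close>
lemma cond_cdf_is_cdf:
  assumes "\<And>i. 0 \<le> \<tau> i" and "0 \<le> z"
  shows "\<exists>\<nu>. real_distribution \<nu> \<and> measure \<nu> {0..1} = 1 \<and> (\<forall>s\<in>{0..1}. cond_cdf N \<tau> z s = cdf \<nu> s)"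
proof (cases "measure_pmf.prob N {i. z \<le> Z_max (\<tau> i)} = 0")
  case True
  let ?\<nu> = "return borel (0::real)"
  have "real_distribution ?\<nu>"
    by (intro real_distribution.intro real_distribution_axioms.intro prob_space_return) auto
  moreover have "measure ?\<nu> {0..1} = 1" by (subst measure_return) auto
  moreover have "cond_cdf N \<tau> z s = cdf ?\<nu> s" if "s \<in> {0..1}" for s
    using that True unfolding cdf_def by (subst measure_return) (auto simp: cond_cdf_def)
  ultimately show ?thesis by blast
next
  case False
  let ?A = "{i. z \<le> Z_max (\<tau> i)}"
  have ne: "set_pmf N \<inter> ?A \<noteq> {}"
    using False by (auto simp: measure_pmf_zero_iff)
  let ?P = "cond_pmf N ?A"
  let ?f = "\<lambda>i. z * XZ_ratio (\<tau> i)"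
  let ?\<nu> = "distr (measure_pmf ?P) borel ?f"
  have "real_distribution ?\<nu>"
    by (rule prob_space.real_distribution_distr[OF prob_space_measure_pmf]) simp
  moreover have "measure ?\<nu> {0..1} = 1"
  proof -
    have "?f i \<in> {0..1}" if "z \<le> Z_max (\<tau> i)" for i
    proof -
      have "?f i \<le> Z_max (\<tau> i) * XZ_ratio (\<tau> i)"
        using that XZ_ratio_nonneg[OF assms(1)] by (rule mult_right_mono)
      also have "\<dots> \<le> 1" using Z_max_pos[of "\<tau> i"] by (simp add: XZ_ratio_def)
      finally show ?thesis using assms XZ_ratio_nonneg[OF assms(1)] by simp
    qed
    then have "AE i in measure_pmf ?P. i \<in> ?f -` {0..1}"
      by (auto simp: AE_measure_pmf_iff set_cond_pmf[OF ne])
    then show ?thesis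
      by (simp add: measure_distr measure_pmf.prob_eq_1)
  qed
  moreover have "cond_cdf N \<tau> z s = cdf ?\<nu> s" for s
  proof -
    have "measure_pmf.prob ?P S = measure_pmf.prob N (?A \<inter> S) / measure_pmf.prob N ?A" for S
      using False unfolding cond_pmf.rep_eq[OF ne]
      by (subst measure_uniform_measure) (auto simp: measure_pmf.emeasure_eq_measure)
    then show ?thesis
      using False unfolding cdf_def
      by (subst measure_distr) (auto simp: cond_cdf_def vimage_def Int_def)
  qed
  ultimately show ?thesis by blast
qed

lemma cond_cdf_bounds: "0 \<le> cond_cdf N \<tau> z s" "cond_cdf N \<tau> z s \<le> 1"
proof -
  have "measure_pmf.prob N {i. z \<le> Z_max (\<tau> i) \<and> z * XZ_ratio (\<tau> i) \<le> s}
      \<le> measure_pmf.prob N {i. z \<le> Z_max (\<tau> i)}"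
    by (rule measure_pmf.finite_measure_mono) auto
  then show "0 \<le> cond_cdf N \<tau> z s" "cond_cdf N \<tau> z s \<le> 1"
    by (auto simp: cond_cdf_def divide_simps)
qed

text \<open>On an event \<open>Z \<in> B\<close>, both the indicator of \<open>X \<le> s\<close> and \<open>cond_cdf N \<tau> Z s\<close> are functions of \<open>Z\<close> and
  \<open>T\<^sub>i\<close>. By \<open>nn_integral_law\<close> it is enough to compare, for each fixed \<open>z\<close>, their integrals over the
  index, and these agree by \<open>cond_cdf_times_weight\<close>.\<close>
lemma cond_cdf_version_law:
  assumes "0 < c" and prob: "prob_space (tilted N \<tau> c)" and \<tau>: "\<And>i. 0 \<le> \<tau> i"
  shows "cond_cdf_version (exp4_law \<Otimes>\<^sub>M tilted N \<tau> c) (cond_cdf N \<tau>)"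
proof -
  let ?\<mu> = "exp4_law \<Otimes>\<^sub>M tilted N \<tau> c"
  let ?F = "vimage_algebra (space ?\<mu>) Z_var borel"
  interpret E: prob_space exp4_law by (rule prob_space_exp4_law)
  interpret T: prob_space "tilted N \<tau> c" by (rule prob)
  interpret ET: pair_prob_space exp4_law "tilted N \<tau> c" ..
  have space: "space ?\<mu> = UNIV"
    by (simp add: space_pair_measure tilted_def)
  have Z_meas: "Z_var \<in> borel_measurable ?\<mu>"
    by measurable
  have Z_in: "Z_var \<in> space ?\<mu> \<rightarrow> space (borel :: real measure)"
    by simp
  have sub: "subalgebra ?\<mu> ?F"
    unfolding subalgebra_def sets_vimage_algebra2[OF Z_in]
    using measurable_sets[OF Z_meas] by auto
  interpret S: finite_measure_subalgebra ?\<mu> ?F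
    by standard (fact sub)
  have AE: "AE p in ?\<mu>. real_cond_exp ?\<mu> ?F (indicator {p'. X_var p' \<le> s}) p = cond_cdf N \<tau> (Z_var p) s" for s
  proof (rule S.real_cond_exp_charact)
    have [measurable]: "(\<lambda>z. cond_cdf N \<tau> z s) \<in> borel_measurable borel"
      by (rule cond_cdf_measurable[OF \<tau>])
    have ev: "{p'. X_var p' \<le> s} \<in> sets ?\<mu>"
    proof -
      have "{p' \<in> space ?\<mu>. X_var p' \<le> s} \<in> sets ?\<mu>" by measurable
      then show ?thesis by (simp add: space)
    qed
    show int1: "integrable ?\<mu> (indicator {p'. X_var p' \<le> s} :: _ \<Rightarrow> real)"
      using ev by (intro integrable_real_indicator) (auto simp: less_top[symmetric])
    show int2: "integrable ?\<mu> (\<lambda>p. cond_cdf N \<tau> (Z_var p) s)"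
      by (rule ET.P.integrable_const_bound[where B = 1]) (auto simp: cond_cdf_bounds)
    have "Z_var \<in> measurable ?F borel"
      by (rule measurable_vimage_algebra1) simp
    then show "(\<lambda>p. cond_cdf N \<tau> (Z_var p) s) \<in> borel_measurable ?F"
      by measurable
    fix A assume "A \<in> sets ?F"
    then obtain B where B[measurable]: "B \<in> sets borel" and A: "A = Z_var -` B"
      by (auto simp: sets_vimage_algebra2 space)
    \<comment> \<open>the two integrands over \<open>A\<close>, as functions of \<open>(Z, T\<^sub>i)\<close>\<close>
    let ?g1 = "\<lambda>q. indicator {q. fst q \<in> B \<and> fst q * XZ_ratio (snd q) \<le> s} q :: ennreal"
    let ?g2 = "\<lambda>q. indicator B (fst q) * ennreal (cond_cdf N \<tau> (fst q) s)"
    have A_sets [measurable]: "A \<in> sets ?\<mu>"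
      using \<open>A \<in> sets ?F\<close> sub by (auto simp: subalgebra_def)
    have "(\<integral>\<^sup>+p. ?g1 (Z_var p, snd p) \<partial>?\<mu>) = (\<integral>\<^sup>+p. ?g2 (Z_var p, snd p) \<partial>?\<mu>)"
    proof -
      have "(\<integral>\<^sup>+i. indicator {0..Z_max (\<tau> i)} z * ?g1 (z, \<tau> i) \<partial>measure_pmf N) =
          (\<integral>\<^sup>+i. indicator {0..Z_max (\<tau> i)} z * ?g2 (z, \<tau> i) \<partial>measure_pmf N)" for z
      proof (cases "0 \<le> z \<and> z \<in> B")
        case True
        have "(\<integral>\<^sup>+i. indicator {0..Z_max (\<tau> i)} z * ?g1 (z, \<tau> i) \<partial>measure_pmf N) =
            (\<integral>\<^sup>+i. indicator {i. z \<le> Z_max (\<tau> i) \<and> z * XZ_ratio (\<tau> i) \<le> s} i \<partial>measure_pmf N)"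
          using True by (intro nn_integral_cong) (auto split: split_indicator)
        also have "\<dots> = ennreal (cond_cdf N \<tau> z s * measure_pmf.prob N {i. z \<le> Z_max (\<tau> i)})"
          by (simp add: measure_pmf.emeasure_eq_measure cond_cdf_times_weight)
        also have "\<dots> = ennreal (cond_cdf N \<tau> z s) *
            (\<integral>\<^sup>+i. indicator {i. z \<le> Z_max (\<tau> i)} i \<partial>measure_pmf N)"
          by (simp add: measure_pmf.emeasure_eq_measure ennreal_mult cond_cdf_bounds)
        also have "\<dots> = (\<integral>\<^sup>+i. ennreal (cond_cdf N \<tau> z s) * indicator {i. z \<le> Z_max (\<tau> i)} i \<partial>measure_pmf N)"
          by (rule nn_integral_cmult[symmetric]) simp
        also have "\<dots> = (\<integral>\<^sup>+i. indicator {0..Z_max (\<tau> i)} z * ?g2 (z, \<tau> i) \<partial>measure_pmf N)"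
          using True by (intro nn_integral_cong) (auto split: split_indicator)
        finally show ?thesis .
      next
        case False
        then show ?thesis by (intro nn_integral_cong) (auto split: split_indicator)
      qed
      note eq = this
      have [measurable]: "?g1 \<in> borel_measurable (borel \<Otimes>\<^sub>M borel)"
        by measurable
      have [measurable]: "?g2 \<in> borel_measurable (borel \<Otimes>\<^sub>M borel)"
        by measurable
      show ?thesis
        by (subst (1 2) nn_integral_law[OF \<open>0 < c\<close> prob]) (simp_all only: eq, measurable)
    qed
    moreover have "(\<integral>\<^sup>+p. ?g1 (Z_var p, snd p) \<partial>?\<mu>) = (\<integral>\<^sup>+p. ennreal (indicator A p *\<^sub>R indicator {p'. X_var p' \<le> s} p) \<partial>?\<mu>)"
      by (intro nn_integral_cong) (auto simp: A X_var_eq split: split_indicator)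
    moreover have "(\<integral>\<^sup>+p. ?g2 (Z_var p, snd p) \<partial>?\<mu>) = (\<integral>\<^sup>+p. ennreal (indicator A p *\<^sub>R cond_cdf N \<tau> (Z_var p) s) \<partial>?\<mu>)"
      by (intro nn_integral_cong) (auto simp: A split: split_indicator)
    ultimately show "(\<integral>p\<in>A. indicator {p'. X_var p' \<le> s} p \<partial>?\<mu>) = (\<integral>p\<in>A. cond_cdf N \<tau> (Z_var p) s \<partial>?\<mu>)"
      using ev unfolding set_lebesgue_integral_def
      by (subst (1 2) integral_eq_nn_integral) (auto simp: cond_cdf_bounds)
  qed
  show ?thesis
    unfolding cond_cdf_version_def
    using cond_cdf_is_cdf[OF \<tau>] cond_cdf_measurable[OF \<tau>] AE
    by (auto intro!: measurable_restrict_space1)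
qed

section \<open>Power law weights and times\<close>

text \<open>Index \<open>i\<close> stands for \<open>n = i + 1\<close>, both here and in \<open>power_time\<close>.\<close>
definition power_pmf :: "real \<Rightarrow> nat pmf" where
  "power_pmf b = embed_pmf (\<lambda>i. real (Suc i) powr (- b) - real (Suc (Suc i)) powr (- b))"

definition power_time :: "real \<Rightarrow> nat \<Rightarrow> real" where
  "power_time a i = real (Suc i) powr (- a)"

text \<open>The inverse of \<open>XZ_ratio\<close> on \<open>(0,1)\<close>; see \<open>XZ_ratio_le_iff\<close>.\<close>
definition time_bound :: "real \<Rightarrow> real" where
  "time_bound x = ln ((1 + 2 * x) / (1 - x)) / 4"

lemma power_time_pos: "0 < power_time a i"
  by (simp add: power_time_def)

lemma power_weight_nonneg:
  "0 < b \<Longrightarrow> 0 \<le> real (Suc i) powr (- b) - real (Suc (Suc i)) powr (- b)"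
  by (simp add: powr_mono2')

lemma power_weight_sums:
  assumes "0 < b"
  shows "(\<lambda>i. real (Suc i) powr (- b) - real (Suc (Suc i)) powr (- b)) sums 1"
proof -
  have "(\<lambda>i. real (Suc i) powr (- b)) \<longlonglongrightarrow> 0"
    using assms by real_asymp
  from telescope_sums'[OF this] show ?thesis by simp
qed

lemma pmf_power_pmf:
  assumes "0 < b"
  shows "pmf (power_pmf b) i = real (Suc i) powr (- b) - real (Suc (Suc i)) powr (- b)"
  unfolding power_pmf_def
proof (rule pmf_embed_pmf)
  show "0 \<le> real (Suc i) powr (- b) - real (Suc (Suc i)) powr (- b)" for i
    by (rule power_weight_nonneg[OF assms])
  show "(\<integral>\<^sup>+i. ennreal (real (Suc i) powr (- b) - real (Suc (Suc i)) powr (- b)) \<partial>count_space UNIV) = 1"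
    using power_weight_sums[OF assms] power_weight_nonneg[OF assms]
    by (subst nn_integral_count_space_nat, subst suminf_ennreal2)
       (auto simp: sums_iff)
qed

lemma power_pmf_tail:
  assumes "0 < b"
  shows "measure_pmf.prob (power_pmf b) {m..} = real (Suc m) powr (- b)"
proof -
  have "measure_pmf.prob (power_pmf b) {..<m} = (\<Sum>i<m. real (Suc i) powr (- b) - real (Suc (Suc i)) powr (- b))"
    by (simp add: measure_measure_pmf_finite pmf_power_pmf[OF assms])
  also have "\<dots> = 1 - real (Suc m) powr (- b)"
    by (subst sum_lessThan_telescope') simp
  finally have "measure_pmf.prob (power_pmf b) {..<m} = 1 - real (Suc m) powr (- b)" .
  moreover have "{m..} = UNIV - {..<m}" by auto
  ultimately show ?thesis
    using measure_pmf.prob_compl[of "{..<m}" "power_pmf b"] by simp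
qed

text \<open>The condition on \<open>n = i + 1\<close> is \<open>n \<ge> \<lceil>v\<rceil>\<close>, so the mass is exactly \<open>\<lceil>v\<rceil> powr -b\<close>.\<close>
lemma power_pmf_tail_bounds:
  assumes "0 < b" and "0 < v"
  shows "(v + 1) powr (- b) \<le> measure_pmf.prob (power_pmf b) {i. v \<le> real (Suc i)}"
    and "measure_pmf.prob (power_pmf b) {i. v \<le> real (Suc i)} \<le> v powr (- b)"
proof -
  define m where "m = nat \<lceil>v\<rceil> - 1"
  have Suc_m: "Suc m = nat \<lceil>v\<rceil>"
    using \<open>0 < v\<close> by (simp add: m_def)
  then have m: "v \<le> real (Suc m)" "real (Suc m) \<le> v + 1"
    using \<open>0 < v\<close> by linarith+
  have "{i. v \<le> real (Suc i)} = {m..}"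
  proof (intro set_eqI iffI)
    fix i assume "i \<in> {i. v \<le> real (Suc i)}"
    then have "nat \<lceil>v\<rceil> \<le> Suc i" by (subst nat_ceiling_le_eq) simp
    then have "Suc m \<le> Suc i" unfolding Suc_m .
    then show "i \<in> {m..}" by simp
  next
    fix i assume "i \<in> {m..}"
    then have "real (Suc m) \<le> real (Suc i)" by simp
    then show "i \<in> {i. v \<le> real (Suc i)}" using m by simp
  qed
  then have eq: "measure_pmf.prob (power_pmf b) {i. v \<le> real (Suc i)} = real (Suc m) powr (- b)"
    by (simp only: power_pmf_tail[OF \<open>0 < b\<close>])
  show "(v + 1) powr (- b) \<le> measure_pmf.prob (power_pmf b) {i. v \<le> real (Suc i)}"
    unfolding eq using m assms by (intro powr_mono2') auto
  show "measure_pmf.prob (power_pmf b) {i. v \<le> real (Suc i)} \<le> v powr (- b)"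
    unfolding eq using m assms by (intro powr_mono2') auto
qed

lemma power_time_le_iff:
  assumes "0 < a" and "0 < p"
  shows "power_time a i \<le> p \<longleftrightarrow> p powr (- 1 / a) \<le> real (Suc i)"
proof -
  have "power_time a i \<le> p \<longleftrightarrow> ln (power_time a i) \<le> ln p"
    using assms power_time_pos[of a i] by simp
  also have "\<dots> \<longleftrightarrow> - 1 / a * ln p \<le> ln (real (Suc i))"
    using \<open>0 < a\<close> by (auto simp: power_time_def ln_powr field_simps)
  also have "\<dots> \<longleftrightarrow> ln (p powr (- 1 / a)) \<le> ln (real (Suc i))"
    using assms by (simp add: ln_powr)
  also have "\<dots> \<longleftrightarrow> p powr (- 1 / a) \<le> real (Suc i)"
    using assms by (subst ln_le_cancel_iff) auto
  finally show ?thesis .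
qed

lemma prob_power_time_le_lower:
  assumes "0 < a" and "0 < b" and "0 < p"
  shows "(p powr (- 1 / a) + 1) powr (- b) \<le> measure_pmf.prob (power_pmf b) {i. power_time a i \<le> p}"
  unfolding power_time_le_iff[OF \<open>0 < a\<close> \<open>0 < p\<close>]
  using assms by (intro power_pmf_tail_bounds) auto

text \<open>With \<open>v = p powr (-1 / a)\<close>, the probability lies between \<open>(v + 1) powr -b\<close> and
  \<open>v powr -b = p powr (b / a)\<close>. The ratio \<open>(1 + 1 / v) powr -b\<close> of the two bounds is at least
  \<open>1 - b / v\<close> by Bernoulli's inequality, and \<open>1 / v = p powr (1 / a) \<le> p\<^sup>3\<close>. This is where
  \<open>3 a \<le> 1\<close> enters.\<close>
lemma prob_power_time_le_approx:
  assumes "0 < a" and "3 * a \<le> 1" and "0 < b" and "0 < p" and "p \<le> 1"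
  shows "\<bar>measure_pmf.prob (power_pmf b) {i. power_time a i \<le> p} - p powr (b / a)\<bar>
    \<le> b * p powr (b / a + 3)"
proof -
  define v where "v = p powr (- 1 / a)"
  have v: "0 < v" using \<open>0 < p\<close> by (simp add: v_def)
  let ?P = "measure_pmf.prob (power_pmf b) {i. power_time a i \<le> p}"
  have bounds: "(v + 1) powr (- b) \<le> ?P" "?P \<le> v powr (- b)"
    unfolding power_time_le_iff[OF \<open>0 < a\<close> \<open>0 < p\<close>] v_def[symmetric]
    using power_pmf_tail_bounds[OF \<open>0 < b\<close> v] by auto
  have vb: "v powr (- b) = p powr (b / a)"
    by (simp add: v_def powr_powr)
  have inv_v: "1 / v \<le> p powr 3"
  proof -
    have "1 / v = p powr (1 / a)" using \<open>0 < p\<close> by (simp add: v_def powr_minus_divide)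
    also have "\<dots> \<le> p powr 3"
      using assms by (intro powr_mono') (auto simp: field_simps)
    finally show ?thesis .
  qed
  have "1 - b * p powr 3 \<le> 1 - b * (1 / v)"
    using mult_left_mono[OF inv_v, of b] \<open>0 < b\<close> by simp
  also have "\<dots> \<le> exp (- b * (1 / v))"
    using exp_ge_add_one_self[of "- b * (1 / v)"] by simp
  also have "\<dots> \<le> exp (- b * ln (1 + 1 / v))"
    using v \<open>0 < b\<close> mult_left_mono[OF ln_add_one_self_le_self[of "1 / v"], of b] by simp
  also have "\<dots> = (1 + 1 / v) powr (- b)"
    using v by (simp add: powr_def add_pos_pos[THEN less_imp_neq, symmetric])
  finally have "v powr (- b) * (1 - b * p powr 3) \<le> v powr (- b) * (1 + 1 / v) powr (- b)"
    by (intro mult_left_mono) auto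
  also have "\<dots> = (v + 1) powr (- b)"
    using v by (subst powr_mult[symmetric]) (auto simp: algebra_simps)
  finally have "v powr (- b) - b * (v powr (- b) * p powr 3) \<le> ?P"
    using bounds by (simp add: algebra_simps)
  moreover have "v powr (- b) * p powr 3 = p powr (b / a + 3)"
    by (simp add: vb powr_add)
  ultimately show ?thesis
    using bounds by (simp add: vb)
qed

section \<open>Expansion of the conditional distribution function\<close>

lemma XZ_ratio_eq: "XZ_ratio u = (3 - Z_max u) / (2 * Z_max u)"
  using Z_max_pos[of u] by (simp add: XZ_ratio_def Z_max_def field_simps)

lemma XZ_ratio_pos: "0 < u \<Longrightarrow> 0 < XZ_ratio u"
  using Z_max_pos[of u] by (simp add: XZ_ratio_def)

lemma XZ_ratio_le_iff:
  assumes "0 < x" and "x < 1"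
  shows "XZ_ratio u \<le> x \<longleftrightarrow> u \<le> time_bound x"
proof -
  have "XZ_ratio u \<le> x \<longleftrightarrow> (1 - x) / (1 + 2 * x) \<le> exp (-4 * u)"
    using Z_max_pos[of u] assms by (simp add: XZ_ratio_def Z_max_def field_simps)
  also have "\<dots> \<longleftrightarrow> ln ((1 - x) / (1 + 2 * x)) \<le> -4 * u"
    using assms by (subst ln_le_cancel_iff[symmetric]) auto
  also have "\<dots> \<longleftrightarrow> u \<le> time_bound x"
    using assms by (auto simp: time_bound_def ln_div)
  finally show ?thesis .
qed

text \<open>The coefficients come from
  \<open>time_bound x = 3/4 * x * (1 - x / 2 + x\<^sup>2 + O(x\<^sup>3))\<close> and the binomial series
  \<open>(1 + u) powr p = 1 + p * u + p * (p - 1) / 2 * u\<^sup>2 + O(u\<^sup>3)\<close>.\<close>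
lemma time_bound_powr_expansion:
  fixes p :: real assumes "0 < p"
  shows "(\<lambda>x. time_bound x powr p -
     (3/4) powr p * (x powr p - p / 2 * x powr (p + 1) + (p + p * (p - 1) / 8) * x powr (p + 2)))
     \<in> O[at_right 0](\<lambda>x. x powr (p + 3))"
  unfolding time_bound_def using assms by real_asymp

text \<open>By \<open>XZ_ratio_le_iff\<close> the event is \<open>power_time a i \<le> time_bound x\<close>. Its probability is
  \<open>time_bound x powr (b / a)\<close> up to a rounding error of the order of the remainder.\<close>
lemma prob_XZ_ratio_le_expansion:
  assumes "0 < a" and "3 * a \<le> 1" and "0 < b"
  shows "\<exists>K>0. \<exists>x0>0. \<exists>d :: nat \<Rightarrow> real. \<forall>x\<in>{0..x0}.
      \<bar>measure_pmf.prob (power_pmf b) {i. XZ_ratio (power_time a i) \<le> x} -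
        (\<Sum>j<3. d j * x powr (b / a + real j))\<bar> \<le> K * x powr (b / a + 3)"
proof -
  define p where "p = b / a"
  have p: "0 < p" using assms by (simp add: p_def)
  define d where "d j = (3/4) powr p * (if j = 0 then 1 else if j = 1 then - (p / 2) else p + p * (p - 1) / 8)" for j :: nat
  let ?E = "\<lambda>x. time_bound x powr p - (\<Sum>j<3. d j * x powr (p + real j))"
  let ?H = "\<lambda>x. measure_pmf.prob (power_pmf b) {i. XZ_ratio (power_time a i) \<le> x}"
  have "?E \<in> O[at_right 0](\<lambda>x. x powr (p + 3))"
    using time_bound_powr_expansion[OF p]
    by (simp add: d_def eval_nat_numeral algebra_simps)
  then obtain K1 where K1: "0 < K1" "\<forall>\<^sub>F x in at_right 0. norm (?E x) \<le> K1 * norm (x powr (p + 3))"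
    by (rule landau_o.bigE)
  have "(\<lambda>x. time_bound x powr (p + 3)) \<in> O[at_right 0](\<lambda>x. x powr (p + 3))"
    unfolding time_bound_def using p by real_asymp
  then obtain K2 where K2: "0 < K2" "\<forall>\<^sub>F x in at_right 0. norm (time_bound x powr (p + 3)) \<le> K2 * norm (x powr (p + 3))"
    by (rule landau_o.bigE)
  have "\<forall>\<^sub>F x in at_right 0. 0 < time_bound x \<and> time_bound x \<le> 1 \<and> x < 1"
    unfolding time_bound_def by (intro eventually_conj; real_asymp)
  with K1(2) K2(2)
  have "\<forall>\<^sub>F x in at_right 0. \<bar>?H x - (\<Sum>j<3. d j * x powr (p + real j))\<bar> \<le> (K1 + b * K2) * x powr (p + 3)"
    using eventually_at_right_less[of "0 :: real"]
  proof eventually_elim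
    case (elim x)
    then have x: "0 < x" "x < 1" and T: "0 < time_bound x" "time_bound x \<le> 1" by auto
    have "\<bar>?H x - time_bound x powr p\<bar> \<le> b * time_bound x powr (p + 3)"
      unfolding XZ_ratio_le_iff[OF x] p_def
      by (rule prob_power_time_le_approx) (use assms T in auto)
    also have "\<dots> \<le> b * (K2 * x powr (p + 3))"
      using elim assms by (intro mult_left_mono) auto
    finally have "\<bar>?H x - time_bound x powr p\<bar> \<le> b * K2 * x powr (p + 3)" by simp
    moreover have "\<bar>?E x\<bar> \<le> K1 * x powr (p + 3)" using elim by simp
    ultimately show ?case by (simp add: algebra_simps)
  qed
  then obtain x1 where x1: "0 < x1"
    "\<And>x. 0 < x \<Longrightarrow> x < x1 \<Longrightarrow> \<bar>?H x - (\<Sum>j<3. d j * x powr (p + real j))\<bar> \<le> (K1 + b * K2) * x powr (p + 3)"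
    unfolding eventually_at_right_field by auto
  show ?thesis
  proof (intro exI conjI ballI)
    show "0 < K1 + b * K2" using K1 K2 assms by (simp add: add_pos_pos)
    show "0 < x1 / 2" using x1 by simp
    fix x assume "x \<in> {0..x1 / 2}"
    then have x: "0 \<le> x" "x \<le> x1 / 2" by auto
    show "\<bar>?H x - (\<Sum>j<3. d j * x powr (b / a + real j))\<bar> \<le> (K1 + b * K2) * x powr (b / a + 3)"
    proof (cases "x = 0")
      case True
      have "{i. XZ_ratio (power_time a i) \<le> x} = {}"
        using XZ_ratio_pos[OF power_time_pos] True by (auto simp: not_le)
      then show ?thesis using True by simp
    next
      case False
      then show ?thesis using x x1 by (auto simp: p_def)
    qed
  qed
qed

text \<open>For \<open>z\<close> in a compact interval \<open>[lo, hi]\<close> inside \<open>(0,3)\<close> and small \<open>s\<close>, a time with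
  \<open>XZ_ratio u \<le> s / z\<close> is so short that \<open>hi \<le> Z_max u\<close>, so the condition \<open>z \<le> Z_max u\<close> in the
  numerator of \<open>cond_cdf\<close> is automatic. What remains is a function of \<open>s / z\<close>, expanded in
  \<open>prob_XZ_ratio_le_expansion\<close>, divided by \<open>W z\<close>, which is bounded below by \<open>W hi > 0\<close>.\<close>
lemma tempered_expansion_power:
  assumes "0 < a" and "3 * a \<le> 1" and "0 < b" and "0 < t"
    and \<epsilon>: "\<epsilon> 0 = 0" "\<epsilon> 1 = 1" "\<epsilon> 2 = 2" "\<epsilon> 3 = 3"
  shows "tempered_expansion (cond_cdf (power_pmf b) (power_time a)) t 3 (b / a) \<epsilon>"
proof -
  define p where "p = b / a"
  have p: "0 < p" using assms by (simp add: p_def)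
  obtain K x0 :: real and d :: "nat \<Rightarrow> real" where K: "0 < K" and x0: "0 < x0"
    and H: "\<forall>x\<in>{0..x0}.
      \<bar>measure_pmf.prob (power_pmf b) {i. XZ_ratio (power_time a i) \<le> x} -
        (\<Sum>j<3. d j * x powr (p + real j))\<bar> \<le> K * x powr (p + 3)"
    using prob_XZ_ratio_le_expansion[OF assms(1-3)] unfolding p_def by blast
  define z0 where "z0 = 3 * exp (-4 * t)"
  have z0: "0 < z0" "z0 < 3" "4 * q0 t - 1 = z0"
    using \<open>0 < t\<close> by (auto simp: z0_def q0_def add_divide_distrib)
  define lo hi where "lo = z0 / 2" and "hi = (z0 + 3) / 2"
  have lohi: "0 < lo" "lo < z0" "z0 < hi" "hi < 3"
    using z0 by (auto simp: lo_def hi_def)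
  \<comment> \<open>the value of \<open>XZ_ratio\<close> at the time where \<open>Z_max\<close> equals \<open>hi\<close>\<close>
  define \<sigma> where "\<sigma> = (3 - hi) / (2 * hi)"
  have \<sigma>: "0 < \<sigma>" using lohi by (simp add: \<sigma>_def)
  have Z_max_ge: "hi \<le> Z_max u" if "XZ_ratio u \<le> \<sigma>" for u
    using that Z_max_pos[of u] lohi by (simp add: XZ_ratio_eq \<sigma>_def field_simps)
  define W where "W z = measure_pmf.prob (power_pmf b) {i. z \<le> Z_max (power_time a i)}" for z
  have W_hi: "0 < W hi"
  proof -
    have "\<forall>\<^sub>F i in sequentially. hi < Z_max (power_time a i)"
    proof (rule order_tendstoD)
      show "(\<lambda>i. Z_max (power_time a i)) \<longlonglongrightarrow> 3"
        unfolding Z_max_def power_time_def using \<open>0 < a\<close> by real_asymp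
    qed (use lohi in auto)
    then obtain i where i: "hi < Z_max (power_time a i)"
      by (auto simp: eventually_sequentially)
    have "0 < pmf (power_pmf b) i"
      unfolding pmf_power_pmf[OF \<open>0 < b\<close>] using \<open>0 < b\<close> by (simp add: powr_less_mono2_neg)
    also have "\<dots> \<le> W hi"
      unfolding W_def pmf.rep_eq using i by (intro measure_pmf.finite_measure_mono) auto
    finally show ?thesis .
  qed
  have W_ge: "W hi \<le> W z" if "z \<le> hi" for z
    unfolding W_def using that by (intro measure_pmf.finite_measure_mono) auto
  define s0 where "s0 = min 1 (lo * min x0 \<sigma>)"
  have s0: "0 < s0" "s0 \<le> 1" using lohi x0 \<sigma> by (auto simp: s0_def)
  define F where "F j z = d j * z powr (- (p + real j)) / W z" for j z
  define \<kappa> where "\<kappa> = K * lo powr (- (p + 3)) / W hi"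
  have powr_lo: "z powr (- e) \<le> lo powr (- e)" if "lo \<le> z" "0 < e" for z e
    using that lohi by (intro powr_mono2') auto
  have bdd: "bounded (F j ` {lo..hi})" for j
  proof -
    have "norm (F j z) \<le> \<bar>d j\<bar> * lo powr (- (p + real j)) / W hi" if "z \<in> {lo..hi}" for z
    proof -
      have "0 < W z" using W_hi W_ge[of z] that by auto
      then have "norm (F j z) = \<bar>d j\<bar> * z powr (- (p + real j)) / W z"
        by (simp add: F_def abs_mult)
      also have "\<dots> \<le> \<bar>d j\<bar> * lo powr (- (p + real j)) / W hi"
        using that W_hi W_ge[of z] p by (intro frac_le mult_left_mono powr_lo) auto
      finally show ?thesis .
    qed
    then show ?thesis unfolding bounded_iff by blast
  qed
  have main: "\<bar>cond_cdf (power_pmf b) (power_time a) z s - (\<Sum>j<3. F j z * s powr (p + \<epsilon> j))\<bar>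
      \<le> \<kappa> * s powr (p + \<epsilon> 3)" if s: "s \<in> {0..s0}" and z: "z \<in> {lo..hi}" for s z
  proof -
    have zpos: "0 < z" using z lohi by auto
    have Wz: "0 < W z" "W hi \<le> W z" using W_hi W_ge[of z] z by auto
    define x where "x = s / z"
    have "s \<le> lo * min x0 \<sigma>" using s by (simp add: s0_def)
    also have "\<dots> \<le> z * min x0 \<sigma>" using z x0 \<sigma> by (intro mult_right_mono) auto
    finally have "x \<le> min x0 \<sigma>"
      unfolding x_def pos_divide_le_eq[OF zpos] by (simp only: mult.commute)
    then have x: "0 \<le> x" "x \<le> x0" "x \<le> \<sigma>"
      using s zpos by (auto simp: x_def)
    let ?H = "measure_pmf.prob (power_pmf b) {i. XZ_ratio (power_time a i) \<le> x}"
    have "{i. z \<le> Z_max (power_time a i) \<and> z * XZ_ratio (power_time a i) \<le> s} =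
        {i. XZ_ratio (power_time a i) \<le> x}"
    proof -
      have "z * u \<le> s \<longleftrightarrow> u \<le> x" for u using zpos by (simp add: x_def field_simps)
      moreover have "z \<le> Z_max (power_time a i)" if "XZ_ratio (power_time a i) \<le> x" for i
        using Z_max_ge[of "power_time a i"] that x z by auto
      ultimately show ?thesis by auto
    qed
    then have G: "cond_cdf (power_pmf b) (power_time a) z s = ?H / W z"
      using Wz by (simp add: cond_cdf_def W_def)
    have x_powr: "x powr e = z powr (- e) * s powr e" for e
      using s zpos by (simp add: x_def powr_divide powr_minus field_simps)
    have "(\<Sum>j<3. F j z * s powr (p + \<epsilon> j)) = (\<Sum>j<3. d j * x powr (p + real j)) / W z"
      using \<epsilon> unfolding sum_divide_distrib
      by (auto simp: F_def x_powr eval_nat_numeral)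
    then have "\<bar>cond_cdf (power_pmf b) (power_time a) z s - (\<Sum>j<3. F j z * s powr (p + \<epsilon> j))\<bar> =
        \<bar>?H - (\<Sum>j<3. d j * x powr (p + real j))\<bar> / W z"
      using Wz unfolding G by (simp add: diff_divide_distrib[symmetric])
    also have "\<dots> \<le> (K * x powr (p + 3)) / W z"
      using H x Wz by (intro divide_right_mono) auto
    also have "\<dots> = K * z powr (- (p + 3)) / W z * s powr (p + 3)"
      by (simp add: x_powr)
    also have "\<dots> \<le> \<kappa> * s powr (p + 3)"
      unfolding \<kappa>_def using K z p W_hi Wz
      by (intro mult_right_mono frac_le mult_left_mono powr_lo) auto
    finally show ?thesis using \<epsilon> by simp
  qed
  have \<epsilon>_mono: "\<epsilon> i < \<epsilon> (Suc i)" if "i < 3" for i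
  proof -
    have "i = 0 \<or> i = 1 \<or> i = 2" using that by auto
    then show ?thesis using \<epsilon> by (auto simp: eval_nat_numeral)
  qed
  show ?thesis
    unfolding tempered_expansion_def p_def[symmetric]
  proof (intro conjI allI impI)
    show "\<exists>s0 I \<kappa> F. 0 < s0 \<and> s0 \<le> 1 \<and> is_interval I \<and> I \<subseteq> {0<..<3} \<and>
        4 * q0 t - 1 \<in> interior I \<and> 0 < \<kappa> \<and> (\<forall>i<3. bounded (F i ` I)) \<and>
        (\<forall>s\<in>{0..s0}. \<forall>z\<in>I.
          \<bar>cond_cdf (power_pmf b) (power_time a) z s - (\<Sum>i<3. F i z * s powr (p + \<epsilon> i))\<bar>
            \<le> \<kappa> * s powr (p + \<epsilon> 3))"
    proof (rule exI[of _ s0], rule exI[of _ "{lo..hi}"], rule exI[of _ \<kappa>], rule exI[of _ F], intro conjI)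
      show "4 * q0 t - 1 \<in> interior {lo..hi}"
        using z0 lohi by (simp add: interior_atLeastAtMost_real)
      show "0 < \<kappa>" using K W_hi lohi by (simp add: \<kappa>_def)
    qed (use s0 lohi bdd main in \<open>auto simp: is_interval_cc\<close>)
  qed (use \<epsilon> \<epsilon>_mono p in auto)
qed

section \<open>Atoms of \<open>T\<^sub>i\<close> exclude tameness\<close>

lemma atom_imp_not_tame:
  assumes "sets \<mu> = sets (borel :: (real \<times> real) measure)"
    and "0 < emeasure \<mu> (UNIV \<times> {u})"
  shows "\<not> has_tame_density \<mu>"
proof
  assume "has_tame_density \<mu>"
  then obtain f where smooth: "smooth_on quadrant f"
    and f: "\<mu> = density lborel (\<lambda>p. ennreal (f p * indicator quadrant p))"
    unfolding has_tame_density_def by blast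
  from smooth have "C_times_on 0 quadrant f"
    unfolding smooth_on_def by blast
  then have cont: "continuous_on quadrant f"
    by simp
  have line: "UNIV \<times> {u} \<in> null_sets (lborel :: (real \<times> real) measure)"
  proof
    have "emeasure (lborel \<Otimes>\<^sub>M lborel :: (real \<times> real) measure) (UNIV \<times> {u}) = 0"
      by (subst lborel.emeasure_pair_measure_Times) auto
    then show "emeasure lborel (UNIV \<times> {u} :: (real \<times> real) set) = 0"
      by (simp only: lborel_prod)
    have "closed (UNIV \<times> {u} :: (real \<times> real) set)"
      by (intro closed_Times) auto
    then show "UNIV \<times> {u} \<in> sets (lborel :: (real \<times> real) measure)"
      by simp
  qed
  \<comment> \<open>a density with respect to \<open>lborel\<close> is absolutely continuous only once it is known to be measurable\<close>
  have meas: "(\<lambda>p. ennreal (f p * indicator quadrant p)) \<in> borel_measurable lborel"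
  proof -
    have "closed quadrant" unfolding quadrant_def by (intro closed_Times) auto
    then have "(\<lambda>p. indicator quadrant p *\<^sub>R f p) \<in> borel_measurable borel"
      using cont by (intro borel_measurable_continuous_on_indicator) auto
    then show ?thesis by (simp add: mult.commute)
  qed
  have "emeasure \<mu> (UNIV \<times> {u}) = 0"
    using absolutely_continuousI_density[OF meas] line unfolding f absolutely_continuous_def by auto
  with assms show False by simp
qed

section \<open>Subexponential decay of \<open>Q\<close>\<close>

text \<open>By independence \<open>Q\<close> is a product. Bounding \<open>Z_max\<close> below by \<open>1\<close>, it is at least the explicit
  sequence \<open>q\<close>, which decays like a power of \<open>n\<close>; and \<open>Q \<le> 1\<close>.\<close>
lemma tempered_log_power:
  assumes "0 < a" and "0 < b" and "0 < c" and "0 < t"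
    and prob: "prob_space (tilted (power_pmf b) (power_time a) c)"
  shows "tempered_log (exp4_law \<Otimes>\<^sub>M tilted (power_pmf b) (power_time a) c) t"
proof -
  let ?T = "tilted (power_pmf b) (power_time a) c"
  let ?\<mu> = "exp4_law \<Otimes>\<^sub>M ?T"
  interpret E: prob_space exp4_law by (rule prob_space_exp4_law)
  interpret T: prob_space ?T by (rule prob)
  interpret ET: pair_prob_space exp4_law ?T ..
  define C where "C = exp (-4 * t) / c"
  have C: "0 < C" using \<open>0 < c\<close> by (simp add: C_def)
  define q where "q n = C * (1 - exp (- 4 / real n)) * (real n powr (1 / a) + 1) powr (- b)" for n :: nat
  have Te: "exp (-4 * t) - exp (-4 * (t + h)) \<le> measure exp4_law {t..t + h}" if "0 < h" for h
  proof -
    have "distributed exp4_law lborel (\<lambda>x. x) (exponential_density 4)"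
      by (auto simp: distributed_def distr_id2)
    note le = E.exponential_distributedD_le[OF this]
    have "measure exp4_law {..x} = 1 - exp (-4 * x)" if "0 \<le> x" for x
      using le[OF that] by (simp add: atMost_def mult.commute)
    then have "measure exp4_law ({..t + h} - {..t}) = exp (-4 * t) - exp (-4 * (t + h))"
      using that \<open>0 < t\<close> by (subst E.finite_measure_Diff) auto
    moreover have "measure exp4_law ({..t + h} - {..t}) \<le> measure exp4_law {t..t + h}"
      by (rule E.finite_measure_mono) auto
    ultimately show ?thesis by simp
  qed
  have Ti: "1 / c * (h powr (- 1 / a) + 1) powr (- b) \<le> measure ?T {..h}" if "0 < h" for h
  proof -
    let ?A = "{i. power_time a i \<le> h}"
    have "emeasure ?T {..h} =
        (\<integral>\<^sup>+i. ennreal (Z_max (power_time a i) / c) * indicator ?A i \<partial>measure_pmf (power_pmf b))"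
      unfolding tilted_def
      by (subst emeasure_distr, simp, simp, subst emeasure_density)
         (auto intro!: nn_integral_cong split: split_indicator)
    also have "\<dots> \<ge> (\<integral>\<^sup>+i. ennreal (1 / c) * indicator ?A i \<partial>measure_pmf (power_pmf b))"
      using Z_max_gt_1 \<open>0 < c\<close>
      by (intro nn_integral_mono mult_right_mono ennreal_leI divide_right_mono) (auto intro: less_imp_le)
    also have "(\<integral>\<^sup>+i. ennreal (1 / c) * indicator ?A i \<partial>measure_pmf (power_pmf b)) =
        ennreal (1 / c * measure_pmf.prob (power_pmf b) ?A)"
      using \<open>0 < c\<close>
      by (subst nn_integral_cmult_indicator) (simp_all add: measure_pmf.emeasure_eq_measure ennreal_mult[symmetric] del: times_divide_eq_left)
    finally have "1 / c * measure_pmf.prob (power_pmf b) ?A \<le> measure ?T {..h}"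
      by (simp add: T.emeasure_eq_measure)
    moreover have "1 / c * (h powr (- 1 / a) + 1) powr (- b) \<le> 1 / c * measure_pmf.prob (power_pmf b) ?A"
      using prob_power_time_le_lower[OF assms(1,2) that] \<open>0 < c\<close> by (intro mult_left_mono) auto
    ultimately show ?thesis by simp
  qed
  have Q_ge: "q n \<le> Q ?\<mu> t n" if "1 \<le> n" for n
  proof -
    have "{(te, ti). ti \<le> 1 / real n \<and> t \<le> te \<and> te \<le> t + 1 / real n} =
        {t..t + 1 / real n} \<times> {..1 / real n}"
      by auto
    then have "Q ?\<mu> t n = measure exp4_law {t..t + 1 / real n} * measure ?T {..1 / real n}"
      unfolding Q_def measure_def
      by (simp add: T.emeasure_pair_measure_Times enn2real_mult)
    also have "\<dots> \<ge> (exp (-4 * t) - exp (-4 * (t + 1 / real n))) *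
        (1 / c * ((1 / real n) powr (- 1 / a) + 1) powr (- b))"
      using Te[of "1 / real n"] Ti[of "1 / real n"] that \<open>0 < c\<close>
      by (intro mult_mono) auto
    also have "(exp (-4 * t) - exp (-4 * (t + 1 / real n))) *
        (1 / c * ((1 / real n) powr (- 1 / a) + 1) powr (- b)) = q n"
    proof -
      have "exp (-4 * (t + 1 / real n)) = exp (-4 * t) * exp (- 4 / real n)"
        by (simp add: distrib_left exp_add[symmetric])
      moreover have "(1 / real n) powr (- 1 / a) = real n powr (1 / a)"
        using that by (simp add: powr_divide powr_minus)
      ultimately show ?thesis by (simp add: q_def C_def algebra_simps)
    qed
    finally show ?thesis .
  qed
  have q_pos: "0 < q n" if "1 \<le> n" for n
    using that C unfolding q_def
    by (intro mult_pos_pos) (auto simp: add_nonneg_eq_0_iff)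
  have Q_le: "Q ?\<mu> t n \<le> 1" for n
    unfolding Q_def by (rule ET.P.prob_le_1)
  show ?thesis
    unfolding tempered_log_def
  proof
    have "\<forall>\<^sub>F n in sequentially. 1 \<le> n" by (rule eventually_ge_at_top)
    then show "\<forall>\<^sub>F n in sequentially. 0 < Q ?\<mu> t n"
      by eventually_elim (use Q_ge q_pos in \<open>blast intro: less_le_trans\<close>)
    show "(\<lambda>n. ln (Q ?\<mu> t n) / real n) \<longlonglongrightarrow> 0"
    proof (rule tendsto_sandwich)
      show "(\<lambda>n. ln (q n) / real n) \<longlonglongrightarrow> 0"
      proof -
        have "(\<lambda>n. ln C / real n + ln (1 - exp (- 4 / real n)) / real n
            + - b * (ln (real n powr (1 / a) + 1) / real n)) \<longlonglongrightarrow> 0 + 0 + - b * 0"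
        proof (intro tendsto_add tendsto_mult tendsto_const)
          show "(\<lambda>n. ln C / real n) \<longlonglongrightarrow> 0" by real_asymp
          show "(\<lambda>n. ln (1 - exp (- 4 / real n)) / real n) \<longlonglongrightarrow> 0" by real_asymp
          have "0 < 1 / a" using assms by simp
          then show "(\<lambda>n. ln (real n powr (1 / a) + 1) / real n) \<longlonglongrightarrow> 0" by real_asymp
        qed
        moreover have "\<forall>\<^sub>F n in sequentially. ln C / real n + ln (1 - exp (- 4 / real n)) / real n
            + - b * (ln (real n powr (1 / a) + 1) / real n) = ln (q n) / real n"
          using eventually_ge_at_top[of "1 :: nat"]
        proof eventually_elim
          case (elim n)
          have "0 < real n powr (1 / a) + 1" by (rule add_nonneg_pos) auto
          moreover have "exp (- 4 / real n) < 1" using elim by simp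
          ultimately have "ln (q n) = ln C + ln (1 - exp (- 4 / real n)) + - b * ln (real n powr (1 / a) + 1)"
            unfolding q_def using C by (simp add: ln_mult ln_powr)
          then show ?case by (simp add: add_divide_distrib diff_divide_distrib)
        qed
        ultimately show ?thesis
          by (simp add: tendsto_cong)
      qed
      show "\<forall>\<^sub>F n in sequentially. ln (q n) / real n \<le> ln (Q ?\<mu> t n) / real n"
        using eventually_ge_at_top[of "1 :: nat"]
      proof eventually_elim
        case (elim n)
        then have "ln (q n) \<le> ln (Q ?\<mu> t n)"
          using Q_ge[of n] q_pos[of n] by (subst ln_le_cancel_iff) auto
        then show ?case by (rule divide_right_mono) simp
      qed
      show "\<forall>\<^sub>F n in sequentially. ln (Q ?\<mu> t n) / real n \<le> 0"
        using eventually_ge_at_top[of "1 :: nat"]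
      proof eventually_elim
        case (elim n)
        then have "0 < Q ?\<mu> t n" using Q_ge[of n] q_pos[of n] by linarith
        then have "ln (Q ?\<mu> t n) \<le> 0" using Q_le[of n] by simp
        then show ?case by (simp add: divide_nonpos_nonneg)
      qed
    qed simp
  qed
qed

section \<open>Identification of the law\<close>

text \<open>The common atoms already carry the full mass of \<open>\<nu>\<close>, hence also that of \<open>\<mu>\<close>, and nothing is left
  outside \<open>S\<close>.\<close>
lemma prob_space_eq_if_atoms_eq:
  assumes "prob_space \<mu>" and "prob_space \<nu>"
    and sets: "sets \<mu> = sets (borel :: real measure)" "sets \<nu> = sets (borel :: real measure)"
    and "countable S" and full: "emeasure \<nu> S = 1"
    and atoms: "\<And>x. x \<in> S \<Longrightarrow> emeasure \<mu> {x} = emeasure \<nu> {x}"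
  shows "\<mu> = \<nu>"
proof -
  interpret M: prob_space \<mu> by fact
  interpret N: prob_space \<nu> by fact
  have S [measurable]: "S \<in> sets borel"
    using \<open>countable S\<close> by (rule sets.countable[rotated]) auto
  have sub: "emeasure \<mu> B = emeasure \<nu> B" if "B \<subseteq> S" for B
  proof -
    have "countable B" using that \<open>countable S\<close> by (rule countable_subset)
    then show ?thesis
      using that atoms by (subst (1 2) emeasure_countable_singleton) (auto simp: sets intro!: nn_integral_cong)
  qed
  have AE: "AE x in \<mu>. x \<in> S" "AE x in \<nu>. x \<in> S"
    using sub[of S] full S M.AE_in_set_eq_1[of S] N.AE_in_set_eq_1[of S]
    by (auto simp: sets M.emeasure_eq_measure N.emeasure_eq_measure)
  show ?thesis
  proof (rule measure_eqI)
    fix A assume A: "A \<in> sets \<mu>"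
    have "emeasure \<mu> A = emeasure \<mu> (A \<inter> S)"
      using AE(1) A S by (intro emeasure_eq_AE) (auto simp: sets)
    also have "\<dots> = emeasure \<nu> (A \<inter> S)" by (rule sub) auto
    also have "\<dots> = emeasure \<nu> A"
      using AE(2) A S by (intro emeasure_eq_AE) (auto simp: sets)
    finally show "emeasure \<mu> A = emeasure \<nu> A" .
  qed (simp add: sets)
qed

lemma emeasure_tilted_atom:
  assumes "inj \<tau>" and "0 < c"
  shows "emeasure (tilted N \<tau> c) {\<tau> i} = ennreal (Z_max (\<tau> i) * pmf N i / c)"
proof -
  have "\<tau> -` {\<tau> i} = {i}" using \<open>inj \<tau>\<close> by (auto simp: inj_def)
  then have "emeasure (tilted N \<tau> c) {\<tau> i} =
      (\<integral>\<^sup>+j. ennreal (Z_max (\<tau> j) / c) * indicator {i} j \<partial>measure_pmf N)"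
    unfolding tilted_def by (subst emeasure_distr, simp, simp, subst emeasure_density) auto
  also have "\<dots> = (\<integral>\<^sup>+j. ennreal (Z_max (\<tau> i) / c) * indicator {i} j \<partial>measure_pmf N)"
    by (intro nn_integral_cong) (auto split: split_indicator)
  also have "\<dots> = ennreal (Z_max (\<tau> i) / c) * ennreal (pmf N i)"
    by (subst nn_integral_cmult_indicator) (auto simp: emeasure_pmf_single)
  also have "\<dots> = ennreal (Z_max (\<tau> i) * pmf N i / c)"
    using Z_max_pos[of "\<tau> i"] \<open>0 < c\<close> by (simp add: ennreal_mult[symmetric])
  finally show ?thesis .
qed

lemma emeasure_tilted_range:
  assumes "(\<lambda>i. Z_max (\<tau> i) * pmf N i) sums c" and "0 < c"
  shows "emeasure (tilted N \<tau> c) (range \<tau>) = 1" and "prob_space (tilted N \<tau> c)"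
proof -
  have total: "(\<integral>\<^sup>+i. ennreal (Z_max (\<tau> i) / c) \<partial>measure_pmf N) = 1"
  proof -
    have "(\<lambda>i. pmf N i * (Z_max (\<tau> i) / c)) sums (c / c)"
      using sums_divide[OF assms(1), of c] by (simp add: mult.commute)
    then have s: "(\<lambda>i. pmf N i * (Z_max (\<tau> i) / c)) sums 1" using \<open>0 < c\<close> by simp
    have "(\<integral>\<^sup>+i. ennreal (Z_max (\<tau> i) / c) \<partial>measure_pmf N) =
        (\<Sum>i. ennreal (pmf N i * (Z_max (\<tau> i) / c)))"
      using Z_max_pos \<open>0 < c\<close>
      by (simp add: nn_integral_measure_pmf nn_integral_count_space_nat ennreal_mult less_imp_le del: times_divide_eq_right)
    also have "\<dots> = ennreal (\<Sum>i. pmf N i * (Z_max (\<tau> i) / c))"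
      using Z_max_pos \<open>0 < c\<close> s by (intro suminf_ennreal2) (auto simp: sums_iff less_imp_le)
    also have "\<dots> = 1" using s by (simp add: sums_iff)
    finally show ?thesis .
  qed
  have "range \<tau> \<in> sets borel" by (rule sets.countable) auto
  then show "emeasure (tilted N \<tau> c) (range \<tau>) = 1"
    using total unfolding tilted_def
    by (subst emeasure_distr, simp, simp, subst emeasure_density) auto
  show "prob_space (tilted N \<tau> c)"
  proof
    show "emeasure (tilted N \<tau> c) (space (tilted N \<tau> c)) = 1"
      using total unfolding tilted_def
      by (subst emeasure_distr, simp, simp, subst emeasure_density) auto
  qed
qed

theorem proposition2p7:
  fixes a b R :: real and t y r \<epsilon> :: "nat \<Rightarrow> real"
    and M :: "'w measure" and Te Ti :: "'w \<Rightarrow> real"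
  assumes "0 < a" and "0 < b" and "3 * a < min 1 b"
    and "\<And>n. 1 \<le> n \<Longrightarrow> t n = real n powr (- a)"
    and "\<And>n. 1 \<le> n \<Longrightarrow> y n = 1 + 2 * exp (-4 * t n)"
    and "\<And>n. 1 \<le> n \<Longrightarrow> r n = y n * (real n powr (- b) - real (n + 1) powr (- b))"
    and "R = (\<Sum>n. r (Suc n))"
    and "prob_space M"
    and "prob_space.indep_var M borel Te borel Ti"
    and "distributed M lborel Te (exponential_density 4)"
    and "\<And>n. 1 \<le> n \<Longrightarrow> measure M {\<omega> \<in> space M. Ti \<omega> = t n} = r n / R"
    and "\<epsilon> 0 = 0" and "\<epsilon> 1 = 1" and "\<epsilon> 2 = 2" and "\<epsilon> 3 = 3"
  shows "\<not> has_tame_density (distr M borel (\<lambda>\<omega>. (Te \<omega>, Ti \<omega>)))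
    \<and> tempered (distr M borel (\<lambda>\<omega>. (Te \<omega>, Ti \<omega>)))
    \<and> tempered_with_parameters (distr M borel (\<lambda>\<omega>. (Te \<omega>, Ti \<omega>))) 3 (b / a) \<epsilon>"
proof -
  interpret M: prob_space M by fact
  let ?\<mu> = "distr M borel (\<lambda>\<omega>. (Te \<omega>, Ti \<omega>))"
  let ?N = "power_pmf b" and ?\<tau> = "power_time a"
  let ?T = "tilted ?N ?\<tau> R"
  have t_eq: "t (Suc i) = ?\<tau> i" for i
    using assms(4)[of "Suc i"] by (simp add: power_time_def)
  have r_eq: "r (Suc i) = Z_max (?\<tau> i) * pmf ?N i" for i
    using assms(5,6)[of "Suc i"] by (simp add: t_eq Z_max_def pmf_power_pmf[OF \<open>0 < b\<close>])
  have \<tau>_nonneg: "0 \<le> ?\<tau> i" for i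
    using power_time_pos[of a i] by simp
  have inj: "inj ?\<tau>"
  proof (rule injI)
    fix i j assume "?\<tau> i = ?\<tau> j"
    then have "ln (?\<tau> i) = ln (?\<tau> j)" by simp
    then show "i = j" using \<open>0 < a\<close> by (simp add: power_time_def ln_powr)
  qed
  have summable: "summable (\<lambda>i. r (Suc i))"
  proof (rule summable_comparison_test')
    show "summable (\<lambda>i. 3 * pmf ?N i)"
      using power_weight_sums[OF \<open>0 < b\<close>]
      by (intro summable_mult) (auto simp: pmf_power_pmf[OF \<open>0 < b\<close>] sums_iff)
    show "norm (r (Suc i)) \<le> 3 * pmf ?N i" if "0 \<le> i" for i
      using Z_max_pos[of "?\<tau> i"] Z_max_le_3[OF \<tau>_nonneg, of i]
      by (auto simp: r_eq abs_mult intro!: mult_right_mono)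
  qed
  have pmf_pos: "0 < pmf ?N i" for i
    unfolding pmf_power_pmf[OF \<open>0 < b\<close>] using \<open>0 < b\<close> by (simp add: powr_less_mono2_neg)
  have R_pos: "0 < R"
    unfolding assms(7) using summable
    by (rule suminf_pos) (auto simp: r_eq Z_max_pos pmf_pos)
  have R_sums: "(\<lambda>i. Z_max (?\<tau> i) * pmf ?N i) sums R"
    using summable unfolding assms(7) by (simp add: r_eq summable_sums)
  note T_prob = emeasure_tilted_range(2)[OF R_sums R_pos]
  have rv [measurable]: "Te \<in> borel_measurable M" "Ti \<in> borel_measurable M"
    using M.indep_var_rv1[OF assms(9)] M.indep_var_rv2[OF assms(9)] by auto
  have Te: "distr M borel Te = exp4_law"
    using distributed_distr_eq_density[OF assms(10)] by (simp cong: distr_cong)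
  have Ti_atom: "emeasure (distr M borel Ti) {?\<tau> i} = emeasure ?T {?\<tau> i}" for i
  proof -
    have "emeasure (distr M borel Ti) {?\<tau> i} = emeasure M {\<omega> \<in> space M. Ti \<omega> = ?\<tau> i}"
      by (subst emeasure_distr) (auto intro!: arg_cong[where f = "emeasure M"])
    also have "\<dots> = ennreal (r (Suc i) / R)"
      using assms(11)[of "Suc i"] by (simp add: M.emeasure_eq_measure t_eq)
    finally show ?thesis
      by (simp add: emeasure_tilted_atom[OF inj R_pos] r_eq)
  qed
  have Ti: "distr M borel Ti = ?T"
    by (rule prob_space_eq_if_atoms_eq[OF M.prob_space_distr T_prob, of Ti _ "range ?\<tau>"])
       (use emeasure_tilted_range(1)[OF R_sums R_pos] Ti_atom in auto)
  have law: "?\<mu> = exp4_law \<Otimes>\<^sub>M ?T"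
    using assms(9) unfolding M.indep_var_distribution_eq Te Ti by (simp add: borel_prod)
  have "0 < emeasure ?\<mu> (UNIV \<times> {?\<tau> 0})"
  proof -
    interpret E: prob_space exp4_law by (rule prob_space_exp4_law)
    interpret T: prob_space ?T by (rule T_prob)
    have "emeasure ?\<mu> (UNIV \<times> {?\<tau> 0}) = emeasure exp4_law UNIV * emeasure ?T {?\<tau> 0}"
      unfolding law by (rule T.emeasure_pair_measure_Times) auto
    also have "\<dots> = ennreal (Z_max (?\<tau> 0) * pmf ?N 0 / R)"
      using E.emeasure_space_1 by (simp add: emeasure_tilted_atom[OF inj R_pos])
    also have "\<dots> > 0"
      using Z_max_pos pmf_pos R_pos by (simp add: ennreal_zero_less_divide)
    finally show ?thesis .
  qed
  then have "\<not> has_tame_density ?\<mu>"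
    by (intro atom_imp_not_tame) auto
  moreover have "tempered_with_parameters ?\<mu> 3 (b / a) \<epsilon>"
    unfolding tempered_with_parameters_def
  proof (intro conjI exI[of _ "cond_cdf ?N ?\<tau>"] allI impI)
    show "cond_cdf_version ?\<mu> (cond_cdf ?N ?\<tau>)"
      unfolding law by (rule cond_cdf_version_law[OF R_pos T_prob \<tau>_nonneg])
    show "tempered_expansion (cond_cdf ?N ?\<tau>) u 3 (b / a) \<epsilon>" if "0 < u" for u
      by (rule tempered_expansion_power) (use assms that in auto)
    show "tempered_log ?\<mu> u" if "0 < u" for u
      unfolding law by (rule tempered_log_power) (use assms that R_pos T_prob in auto)
  qed
  moreover from this have "tempered ?\<mu>"
    unfolding tempered_def tempered_with_parameters_def by blast
  ultimately show ?thesis by blast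
qed

end
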